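(* The distribution-based inconsistency degree $I_{\mathcal D}$ satisfies the following properties: (1) Consistency: for every knowledge base $K$, $I_{\mathcal D}(K)=0$ iff $K$ is consistent; (2) Monotony: for all knowledge bases $K,K'$, $I_{\mathcal D}(K)\le I_{\mathcal D}(K\cup K')$; (3) Free Formula Independence: for every knowledge base $K$ and formula $\alpha$, if $\alpha$ is a free formula of $K\cup\{\alpha\}$, then $I_{\mathcal D}(K\cup\{\alpha\})=I_{\mathcal D}(K)$; (4) MinInc: for every knowledge base $K$ and every $M\in\mathrm{MUSes}(K)$, $I_{\mathcal D}(M)=1$; (5) Independent Decomposability: for all knowledge bases $K_1,\ldots,K_n$, if $\mathrm{MUSes}(K_1\cup\cdots\cup K_n)=\mathrm{MUSes}(K_1)\oplus\cdots\oplus\mathrm{MUSes}(K_n)$ and $\mathrm{unfree}(K_i)\cap\mathrm{unfree}(K_j)=\emptyset$ for all $1\le i\neq j\le n$, then $I_{\mathcal D}(K_1\cup\cdots\cup K_n)=I_{\mathcal D}(K_1)+\cdots+I_{\mathcal D}(K_n)$.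
   Context: Formulae are those of classical propositional logic over a finite set $\mathcal P$ of propositional symbols; $\vdash$ is classical deduction. A knowledge base (KB) is a finite set of formulae; a set of formulae $X$ is inconsistent iff $X\vdash\bot$. A MUS of a KB $K$ is a set $M\subseteq K$ with $M\vdash\bot$ such that no proper subset of $M$ is inconsistent; $\mathrm{MUSes}(K)$ is the set of all MUSes of $K$. A formula $\alpha\in K$ is free in $K$ if it belongs to no MUS of $K$; $\mathrm{free}(K)$ is the set of free formulae and $\mathrm{unfree}(K)=K\setminus\mathrm{free}(K)$. $C=A_1\oplus\cdots\oplus A_n$ means that $C=A_1\cup\cdots\cup A_n$ and the $A_i$ are pairwise disjoint (possibly empty). A partial MUS-decomposition of $K$ is a set $\{K_1,\ldots,K_n\}$ of subsets of $K$ ($n\ge1$) such that (1) $K_i\vdash\bot$ for all $i$; (2) $\mathrm{MUSes}(K_1\cup\cdots\cup K_n)=\mathrm{MUSes}(K_1)\oplus\cdots\oplus\mathrm{MUSes}(K_n)$; (3) $K_i\cap K_j=\emptyset$ for all $i\ne j$. The distribution index $\mu_{\mathcal D}(K)$ is the maximal cardinality of a partial MUS-decomposition of $K$, with $\mu_{\mathcal D}(K)=0$ if $K$ is consistent (i.e. has no partial MUS-decomposition). The distribution-based inconsistency degree is $I_{\mathcal D}(K)=\mu_{\mathcal D}(K)$. *)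

theory Defs
  imports Main "HOL-Library.Disjoint_Sets"
begin

datatype 'a form =
    Atom 'a
  | Bot
  | Neg "'a form"
  | Conj "'a form" "'a form"
  | Disj "'a form" "'a form"
  | Impl "'a form" "'a form"

text \<open>
  Classical deduction, as a natural deduction calculus; every premise set is allowed,
  finite or not.
\<close>

inductive derives :: "'a form set \<Rightarrow> 'a form \<Rightarrow> bool"  (infix "\<turnstile>" 50) where
  assm: "\<phi> \<in> X \<Longrightarrow> X \<turnstile> \<phi>"
| raa: "insert (Neg \<phi>) X \<turnstile> Bot \<Longrightarrow> X \<turnstile> \<phi>"
| negI: "insert \<phi> X \<turnstile> Bot \<Longrightarrow> X \<turnstile> Neg \<phi>"
| negE: "X \<turnstile> Neg \<phi> \<Longrightarrow> X \<turnstile> \<phi> \<Longrightarrow> X \<turnstile> Bot"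
| conjI: "X \<turnstile> \<phi> \<Longrightarrow> X \<turnstile> \<psi> \<Longrightarrow> X \<turnstile> Conj \<phi> \<psi>"
| conjE1: "X \<turnstile> Conj \<phi> \<psi> \<Longrightarrow> X \<turnstile> \<phi>"
| conjE2: "X \<turnstile> Conj \<phi> \<psi> \<Longrightarrow> X \<turnstile> \<psi>"
| disjI1: "X \<turnstile> \<phi> \<Longrightarrow> X \<turnstile> Disj \<phi> \<psi>"
| disjI2: "X \<turnstile> \<psi> \<Longrightarrow> X \<turnstile> Disj \<phi> \<psi>"
| disjE: "X \<turnstile> Disj \<phi> \<psi> \<Longrightarrow> insert \<phi> X \<turnstile> \<chi> \<Longrightarrow> insert \<psi> X \<turnstile> \<chi> \<Longrightarrow> X \<turnstile> \<chi>"
| impI: "insert \<phi> X \<turnstile> \<psi> \<Longrightarrow> X \<turnstile> Impl \<phi> \<psi>"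
| impE: "X \<turnstile> Impl \<phi> \<psi> \<Longrightarrow> X \<turnstile> \<phi> \<Longrightarrow> X \<turnstile> \<psi>"

definition inconsistent :: "'a form set \<Rightarrow> bool" where
  "inconsistent X \<longleftrightarrow> X \<turnstile> Bot"

abbreviation consistent :: "'a form set \<Rightarrow> bool" where
  "consistent X \<equiv> \<not> inconsistent X"

definition MUSes :: "'a form set \<Rightarrow> 'a form set set" where
  "MUSes K = {M. M \<subseteq> K \<and> inconsistent M \<and> (\<forall>N. N \<subset> M \<longrightarrow> \<not> inconsistent N)}"

definition free :: "'a form set \<Rightarrow> 'a form set" where
  "free K = {\<alpha> \<in> K. \<forall>M \<in> MUSes K. \<alpha> \<notin> M}"

definition unfree :: "'a form set \<Rightarrow> 'a form set" where
  "unfree K = K - free K"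

text \<open>\<open>is_oplus C A I\<close> says that \<open>C\<close> is the direct sum of the \<open>A i\<close> for \<open>i \<in> I\<close>. Disjointness is
  between indices, so a set occurring at two distinct indices has to be empty.\<close>

definition is_oplus :: "'b set \<Rightarrow> ('i \<Rightarrow> 'b set) \<Rightarrow> 'i set \<Rightarrow> bool" where
  "is_oplus C A I \<longleftrightarrow> C = (\<Union>i\<in>I. A i) \<and> disjoint_family_on A I"

text \<open>
  A decomposition is a set \<open>D\<close> of knowledge bases, which serves as its own index set. Nothing is
  lost compared with a list of sets indexed by numbers: by disjointness a repeated
  member would be empty, hence consistent.
\<close>

definition partial_MUS_decomposition :: "'a form set \<Rightarrow> 'a form set set \<Rightarrow> bool" where
  "partial_MUS_decomposition K D \<longleftrightarrow>
     finite D \<and> D \<noteq> {} \<and> (\<forall>A\<in>D. A \<subseteq> K) \<and>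
     (\<forall>A\<in>D. inconsistent A) \<and>
     is_oplus (MUSes (\<Union>D)) MUSes D \<and>
     disjoint D"

text \<open>For finite inconsistent \<open>K\<close> the maximum is over a finite nonempty set; for infinite \<open>K\<close>
  it may be unspecified.\<close>

definition distribution_index :: "'a form set \<Rightarrow> nat"  ("\<mu>\<^sub>D") where
  "\<mu>\<^sub>D K = (if consistent K then 0 else Max {card D | D. partial_MUS_decomposition K D})"

definition distribution_degree :: "'a form set \<Rightarrow> nat"  ("I\<^sub>D") where
  "I\<^sub>D K = \<mu>\<^sub>D K"

end

theory Submission imports Defs begin

text \<open>
  Choosing one MUS inside each member of a partial MUS-decomposition yields pairwise disjoint MUSes
  whose union contains no further MUS, and conversely every nonempty such family is itself a partial
  MUS-decomposition. Hence \<open>I\<^sub>D K\<close> is the largest size of such a family, the empty family accounting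
  for consistent \<open>K\<close>, and it depends only on \<open>MUSes K\<close>. For independent decomposability,
  a family for the union splits along the direct sum of the MUS sets; in the other direction,
  families for the parts can be merged because every MUS of a part consists of unfree formulae.
\<close>

section \<open>Soundness and weakening of deduction\<close>

text \<open>The semantics serves to show through soundness that the empty set is consistent, and
  hence that no MUS is empty.\<close>

primrec satisfies :: "('a \<Rightarrow> bool) \<Rightarrow> 'a form \<Rightarrow> bool" where
  "satisfies v (Atom a) \<longleftrightarrow> v a"
| "satisfies v Bot \<longleftrightarrow> False"
| "satisfies v (Neg \<phi>) \<longleftrightarrow> \<not> satisfies v \<phi>"
| "satisfies v (Conj \<phi> \<psi>) \<longleftrightarrow> satisfies v \<phi> \<and> satisfies v \<psi>"
| "satisfies v (Disj \<phi> \<psi>) \<longleftrightarrow> satisfies v \<phi> \<or> satisfies v \<psi>"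
| "satisfies v (Impl \<phi> \<psi>) \<longleftrightarrow> (satisfies v \<phi> \<longrightarrow> satisfies v \<psi>)"

lemma derives_sound:
  assumes "X \<turnstile> \<phi>" and "\<forall>\<psi>\<in>X. satisfies v \<psi>"
  shows "satisfies v \<phi>"
  using assms by (induction rule: derives.induct) auto

lemma consistent_empty: "consistent {}"
  using derives_sound[of "{}" Bot] by (auto simp: inconsistent_def)

lemma derives_mono:
  assumes "X \<turnstile> \<phi>" and "X \<subseteq> Y"
  shows "Y \<turnstile> \<phi>"
  using assms
proof (induction arbitrary: Y rule: derives.induct)
  case (disjE X \<phi> \<psi> \<chi>)
  then show ?case
    by (meson derives.disjE insert_mono)
qed (meson derives.intros insert_mono subsetD)+

lemma inconsistent_mono: "inconsistent X \<Longrightarrow> X \<subseteq> Y \<Longrightarrow> inconsistent Y"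
  unfolding inconsistent_def by (rule derives_mono)

section \<open>Minimal unsatisfiable subsets\<close>

text \<open>The rule names of \<open>derives\<close> shadow those of HOL, hence the qualified \<open>HOL.conjI\<close> and
  \<open>HOL.impI\<close> below.\<close>

lemma MUSes_iff_subset: "M \<in> MUSes K \<Longrightarrow> M \<in> MUSes L \<longleftrightarrow> M \<subseteq> L"
  by (auto simp: MUSes_def)

lemma MUSes_subset: "M \<in> MUSes K \<Longrightarrow> M \<subseteq> K"
  by (simp add: MUSes_def)

lemma MUSes_mono: "K \<subseteq> L \<Longrightarrow> MUSes K \<subseteq> MUSes L"
  by (auto simp: MUSes_def)

lemma MUSes_inconsistent: "M \<in> MUSes K \<Longrightarrow> inconsistent M"
  by (simp add: MUSes_def)

lemma MUSes_antichain: "M \<in> MUSes K \<Longrightarrow> N \<in> MUSes L \<Longrightarrow> M \<subseteq> N \<Longrightarrow> M = N"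
  by (auto simp: MUSes_def)

lemma MUSes_MUS: "M \<in> MUSes K \<Longrightarrow> MUSes M = {M}"
  by (auto simp: MUSes_def)

lemma MUSes_nonempty: "M \<in> MUSes K \<Longrightarrow> M \<noteq> {}"
  using consistent_empty MUSes_inconsistent by auto

text \<open>Descent along proper subsets: either one of them is still inconsistent, or
  \<open>K\<close> is itself minimal.\<close>

lemma ex_MUS:
  assumes "finite K" and "inconsistent K"
  shows "\<exists>M. M \<in> MUSes K"
  using assms
proof (induction rule: finite_psubset_induct)
  case (psubset K)
  show ?case
  proof (cases "\<exists>N\<subset>K. inconsistent N")
    case True
    then obtain N where "N \<subset> K" "inconsistent N" by blast
    with psubset.IH[of N] MUSes_mono[of N K] show ?thesis by blast
  next
    case False
    with psubset.prems have "K \<in> MUSes K" by (auto simp: MUSes_def)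
    then show ?thesis by blast
  qed
qed

lemma finite_MUSes: "finite K \<Longrightarrow> finite (MUSes K)"
  by (rule finite_subset[of _ "Pow K"]) (auto simp: MUSes_def)

lemma MUS_subset_unfree: "M \<in> MUSes K \<Longrightarrow> M \<subseteq> unfree K"
  by (auto simp: MUSes_def unfree_def free_def)

lemma MUSes_insert_free:
  assumes "\<alpha> \<in> free (K \<union> {\<alpha>})"
  shows "MUSes (K \<union> {\<alpha>}) = MUSes K"
proof
  show "MUSes (K \<union> {\<alpha>}) \<subseteq> MUSes K"
  proof
    fix M assume M: "M \<in> MUSes (K \<union> {\<alpha>})"
    with assms have "\<alpha> \<notin> M" by (auto simp: free_def)
    with MUSes_subset[OF M] have "M \<subseteq> K" by auto
    with M show "M \<in> MUSes K" by (simp add: MUSes_iff_subset)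
  qed
qed (rule MUSes_mono, blast)

section \<open>MUS packings and decompositions\<close>

definition MUS_packing :: "'a form set \<Rightarrow> 'a form set set \<Rightarrow> bool" where
  "MUS_packing K S \<longleftrightarrow> S \<subseteq> MUSes K \<and> disjoint S \<and> MUSes (\<Union>S) \<subseteq> S"

lemma MUS_packing_MUSes: "MUS_packing K S \<Longrightarrow> MUSes (\<Union>S) = S"
  unfolding MUS_packing_def using MUSes_iff_subset by blast

lemma MUS_packing_empty: "MUS_packing K {}"
  by (auto simp: MUS_packing_def MUSes_def consistent_empty)

lemma MUS_packing_singleton: "M \<in> MUSes K \<Longrightarrow> MUS_packing K {M}"
  by (simp add: MUS_packing_def MUSes_MUS)

text \<open>Each member is its own only MUS, so the direct sum condition just writes
  \<open>S\<close> as a disjoint union of singletons.\<close>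

lemma MUS_packing_imp_decomposition:
  assumes "finite K" and "MUS_packing K S" and "S \<noteq> {}"
  shows "partial_MUS_decomposition K S"
proof -
  have S: "S \<subseteq> MUSes K" "disjoint S"
    using assms(2) by (auto simp: MUS_packing_def)
  have single: "MUSes M = {M}" if "M \<in> S" for M
    using that S MUSes_MUS by blast
  have "is_oplus (MUSes (\<Union>S)) MUSes S"
    unfolding is_oplus_def MUS_packing_MUSes[OF assms(2)] disjoint_family_on_def
    using single by auto
  moreover have "finite S"
    using S(1) finite_MUSes[OF assms(1)] finite_subset by blast
  ultimately show ?thesis
    unfolding partial_MUS_decomposition_def
    using S assms(3) MUSes_subset MUSes_inconsistent by (metis subsetD)
qed

text \<open>Every member of \<open>D\<close> is shrunk to one MUS inside it, which keeps
  disjointness and the number of members.\<close>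

lemma decomposition_imp_MUS_packing:
  assumes "finite K" and "partial_MUS_decomposition K D"
  shows "\<exists>S. MUS_packing K S \<and> card S = card D"
proof -
  have D: "\<And>A. A \<in> D \<Longrightarrow> A \<subseteq> K" "\<And>A. A \<in> D \<Longrightarrow> inconsistent A"
    "MUSes (\<Union>D) = (\<Union>A\<in>D. MUSes A)"
    "\<And>A B. A \<in> D \<Longrightarrow> B \<in> D \<Longrightarrow> A \<noteq> B \<Longrightarrow> A \<inter> B = {}"
    using assms(2)
    by (auto simp: partial_MUS_decomposition_def is_oplus_def disjoint_def)
  have "\<exists>M. M \<in> MUSes A" if "A \<in> D" for A
    using that D assms(1) ex_MUS finite_subset by metis
  then obtain f where f: "\<And>A. A \<in> D \<Longrightarrow> f A \<in> MUSes A"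
    by metis
  have sub: "f A \<subseteq> A" if "A \<in> D" for A
    using f[OF that] by (rule MUSes_subset)
  have disj: "f A \<inter> f B = {}" if "A \<in> D" "B \<in> D" "A \<noteq> B" for A B
    using D(4)[OF that] sub that by blast
  \<comment> \<open>If two members had the same image, it would be disjoint from itself and thus
    empty, which no MUS is.\<close>
  have "inj_on f D"
    using disj f MUSes_nonempty by (metis inj_onI inf.idem)
  then have "card (f ` D) = card D"
    by (rule card_image)
  moreover have "MUS_packing K (f ` D)"
    unfolding MUS_packing_def
  proof (intro HOL.conjI)
    show "f ` D \<subseteq> MUSes K"
      using D(1) f MUSes_mono by blast
    show "disjoint (f ` D)"
      unfolding disjoint_def using disj by blast
    show "MUSes (\<Union>(f ` D)) \<subseteq> f ` D"
    proof
      fix M assume M: "M \<in> MUSes (\<Union>(f ` D))"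
      have "\<Union>(f ` D) \<subseteq> \<Union>D"
        using sub by blast
      with M have "M \<in> MUSes (\<Union>D)"
        using MUSes_mono by blast
      then obtain A where A: "A \<in> D" "M \<in> MUSes A"
        using D(3) by blast
      \<comment> \<open>A formula of \<open>M\<close> lies in \<open>A\<close> and in some chosen
        \<open>f B\<close>, a subset of \<open>B\<close>; disjointness of the members forces
        \<open>B = A\<close>.\<close>
      have "M \<subseteq> f A"
      proof
        fix x assume x: "x \<in> M"
        with M obtain B where B: "B \<in> D" "x \<in> f B"
          using MUSes_subset by blast
        moreover have "x \<in> A"
          using x A MUSes_subset by blast
        ultimately have "A = B"
          using D(4)[OF A(1) B(1)] sub by blast
        with B show "x \<in> f A" by simp
      qed
      with A f have "M = f A"
        using MUSes_antichain by blast
      with A show "M \<in> f ` D" by simp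
    qed
  qed
  ultimately show ?thesis by blast
qed

section \<open>The degree as the maximal size of a packing\<close>

lemma finite_decomposition_cards:
  assumes "finite K"
  shows "finite {card D | D. partial_MUS_decomposition K D}"
proof -
  have "{D. partial_MUS_decomposition K D} \<subseteq> Pow (Pow K)"
    by (auto simp: partial_MUS_decomposition_def)
  then have "finite {D. partial_MUS_decomposition K D}"
    by (rule finite_subset) (simp add: assms)
  then have "finite (card ` {D. partial_MUS_decomposition K D})"
    by simp
  then show ?thesis
    by (simp add: image_Collect)
qed

lemma MUS_packing_card_le:
  assumes "finite K" and "MUS_packing K S"
  shows "card S \<le> I\<^sub>D K"
\<comment> \<open>A decomposition must be nonempty, so the empty packing is treated apart, with
  cardinality 0. A nonempty one makes \<open>K\<close> inconsistent, which selects the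
  \<open>Max\<close> branch of the index.\<close>
proof (cases "S = {}")
  case False
  then have dec: "partial_MUS_decomposition K S"
    using assms MUS_packing_imp_decomposition by blast
  from False obtain M where "M \<in> MUSes K"
    using assms(2) by (auto simp: MUS_packing_def)
  then have "inconsistent K"
    using MUSes_inconsistent MUSes_subset inconsistent_mono by metis
  with dec finite_decomposition_cards[OF assms(1)] show ?thesis
    by (auto simp: distribution_degree_def distribution_index_def intro!: Max_ge)
qed simp

text \<open>For inconsistent \<open>K\<close> a single MUS shows that the set of cardinalities is
  nonempty, so its maximum is attained; for consistent \<open>K\<close> the empty packing realizes
  the value 0.\<close>

lemma ex_optimal_MUS_packing:
  assumes "finite K"
  shows "\<exists>S. MUS_packing K S \<and> card S = I\<^sub>D K"
proof (cases "inconsistent K")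
  case True
  then obtain M where "M \<in> MUSes K"
    using ex_MUS assms by blast
  then have "{card D | D. partial_MUS_decomposition K D} \<noteq> {}"
    using MUS_packing_imp_decomposition[OF assms MUS_packing_singleton] by blast
  then have "I\<^sub>D K \<in> {card D | D. partial_MUS_decomposition K D}"
    using Max_in[OF finite_decomposition_cards[OF assms]] True
    by (simp add: distribution_degree_def distribution_index_def)
  with decomposition_imp_MUS_packing[OF assms] show ?thesis by force
next
  case False
  then have "MUS_packing K {} \<and> card {} = I\<^sub>D K"
    by (simp add: MUS_packing_empty distribution_degree_def distribution_index_def)
  then show ?thesis by blast
qed

section \<open>Consistency, monotony and the degree of a MUS\<close>

lemma degree_eq_0_iff:
  assumes "finite K"
  shows "I\<^sub>D K = 0 \<longleftrightarrow> consistent K"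
proof
  assume "I\<^sub>D K = 0"
  show "consistent K"
  proof
    assume "inconsistent K"
    then obtain M where "M \<in> MUSes K"
      using ex_MUS assms by blast
    from MUS_packing_card_le[OF assms MUS_packing_singleton[OF this]] \<open>I\<^sub>D K = 0\<close>
    show False by simp
  qed
qed (simp add: distribution_degree_def distribution_index_def)

text \<open>A packing refers to its base only through the MUSes, so an optimal packing of
  \<open>K\<close> is also one of \<open>L\<close>. This gives monotony and, used in both
  directions, free formula independence.\<close>

lemma degree_le_if_MUSes_subset:
  assumes "finite K" and "finite L" and "MUSes K \<subseteq> MUSes L"
  shows "I\<^sub>D K \<le> I\<^sub>D L"
proof -
  obtain S where S: "MUS_packing K S" "card S = I\<^sub>D K"
    using ex_optimal_MUS_packing[OF assms(1)] by blast
  from S(1) assms(3) have "MUS_packing L S"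
    by (auto simp: MUS_packing_def)
  from MUS_packing_card_le[OF assms(2) this] S(2) show ?thesis by simp
qed

lemma degree_MUS:
  assumes "finite K" and "M \<in> MUSes K"
  shows "I\<^sub>D M = 1"
proof -
  have fin: "finite M"
    using assms MUSes_subset finite_subset by blast
  have M: "MUSes M = {M}"
    using assms(2) by (rule MUSes_MUS)
  obtain S where S: "MUS_packing M S" "card S = I\<^sub>D M"
    using ex_optimal_MUS_packing[OF fin] by blast
  then have "S \<subseteq> {M}"
    by (simp add: MUS_packing_def M)
  then have "card S \<le> 1"
    using card_mono[of "{M}" S] by simp
  moreover have "1 \<le> I\<^sub>D M"
    using MUS_packing_card_le[OF fin MUS_packing_singleton[of M M]] M by simp
  ultimately show ?thesis
    using S(2) by simp
qed

section \<open>Independent decomposability\<close>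

text \<open>A MUS within the union of the kept members is a MUS of \<open>\<Union>S\<close>, hence
  in \<open>S\<close>, and it lies inside \<open>L\<close>, hence is kept.\<close>

lemma MUS_packing_restrict:
  assumes "MUS_packing K S"
  shows "MUS_packing L (S \<inter> MUSes L)"
proof -
  have "MUSes (\<Union>(S \<inter> MUSes L)) \<subseteq> MUSes (\<Union>S)"
    by (rule MUSes_mono) blast
  moreover have "MUSes (\<Union>(S \<inter> MUSes L)) \<subseteq> MUSes L"
    by (rule MUSes_mono) (use MUSes_subset in blast)
  ultimately show ?thesis
    using assms by (auto simp: MUS_packing_def disjoint_def)
qed

text \<open>By \<open>MUSes_eq\<close> a MUS of the merged family belongs to a single part;
  disjointness of the unfree formulae then confines it to the packing of that part.\<close>

lemma MUS_packing_UN: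
  assumes MUSes_eq: "MUSes (\<Union>i\<in>I. K i) = (\<Union>i\<in>I. MUSes (K i))"
    and unfree_disj: "\<And>i j. i \<in> I \<Longrightarrow> j \<in> I \<Longrightarrow> i \<noteq> j \<Longrightarrow> unfree (K i) \<inter> unfree (K j) = {}"
    and packing: "\<And>i. i \<in> I \<Longrightarrow> MUS_packing (K i) (S i)"
  shows "MUS_packing (\<Union>i\<in>I. K i) (\<Union>i\<in>I. S i)"
proof -
  have S: "S i \<subseteq> MUSes (K i)" "disjoint (S i)" "MUSes (\<Union>(S i)) \<subseteq> S i" if "i \<in> I" for i
    using packing[OF that] by (auto simp: MUS_packing_def)
  have unfree: "M \<subseteq> unfree (K i)" if "i \<in> I" "M \<in> S i" for i M
    using S(1) that MUS_subset_unfree by blast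
  show ?thesis
    unfolding MUS_packing_def
  proof (intro HOL.conjI)
    show "(\<Union>i\<in>I. S i) \<subseteq> MUSes (\<Union>i\<in>I. K i)"
      using MUSes_eq S(1) by blast
    show "disjoint (\<Union>i\<in>I. S i)"
      unfolding disjoint_def
    proof (intro ballI HOL.impI)
      fix M N assume "M \<in> (\<Union>i\<in>I. S i)" "N \<in> (\<Union>i\<in>I. S i)" and neq: "M \<noteq> N"
      then obtain i j where ij: "i \<in> I" "M \<in> S i" "j \<in> I" "N \<in> S j" by blast
      show "M \<inter> N = {}"
      proof (cases "i = j")
        case True
        with ij neq S(2) show ?thesis by (auto simp: disjoint_def)
      next
        case False
        with ij unfree unfree_disj[of i j] show ?thesis by blast
      qed
    qed
    show "MUSes (\<Union>(\<Union>i\<in>I. S i)) \<subseteq> (\<Union>i\<in>I. S i)"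
    proof
      fix M assume M: "M \<in> MUSes (\<Union>(\<Union>i\<in>I. S i))"
      have "\<Union>(\<Union>i\<in>I. S i) \<subseteq> (\<Union>i\<in>I. K i)"
        using S(1) MUSes_subset by blast
      with M MUSes_eq obtain j where j: "j \<in> I" "M \<in> MUSes (K j)"
        using MUSes_mono by blast
      \<comment> \<open>Each formula of \<open>M\<close> is unfree in \<open>K j\<close>, and also
        in the part \<open>K i\<close> whose packing supplies it, so \<open>i = j\<close>.\<close>
      have "M \<subseteq> \<Union>(S j)"
      proof
        fix x assume x: "x \<in> M"
        with M obtain i N where i: "i \<in> I" "N \<in> S i" "x \<in> N"
          using MUSes_subset by blast
        then have "x \<in> unfree (K i)"
          using unfree by blast
        moreover have "x \<in> unfree (K j)"
          using x j MUS_subset_unfree by blast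
        ultimately have "i = j"
          using unfree_disj i(1) j(1) by blast
        with i show "x \<in> \<Union>(S j)" by blast
      qed
      with M have "M \<in> MUSes (\<Union>(S j))"
        by (simp add: MUSes_iff_subset)
      with S(3) j(1) show "M \<in> (\<Union>i\<in>I. S i)" by blast
    qed
  qed
qed

lemma degree_UN:
  assumes "finite I" and fin: "\<And>i. i \<in> I \<Longrightarrow> finite (K i)"
    and oplus: "is_oplus (MUSes (\<Union>i\<in>I. K i)) (\<lambda>i. MUSes (K i)) I"
    and unfree_disj: "\<And>i j. i \<in> I \<Longrightarrow> j \<in> I \<Longrightarrow> i \<noteq> j \<Longrightarrow> unfree (K i) \<inter> unfree (K j) = {}"
  shows "I\<^sub>D (\<Union>i\<in>I. K i) = (\<Sum>i\<in>I. I\<^sub>D (K i))"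
proof -
  have finU: "finite (\<Union>i\<in>I. K i)"
    using assms(1) fin by blast
  have MUSes_eq: "MUSes (\<Union>i\<in>I. K i) = (\<Union>i\<in>I. MUSes (K i))"
    and disj: "\<And>i j. i \<in> I \<Longrightarrow> j \<in> I \<Longrightarrow> i \<noteq> j \<Longrightarrow> MUSes (K i) \<inter> MUSes (K j) = {}"
    using oplus by (auto simp: is_oplus_def disjoint_family_on_def)
  \<comment> \<open>Shared by both inequalities: cardinalities add up because the MUS sets of
    distinct indices are disjoint.\<close>
  have card_UN: "card (\<Union>i\<in>I. S i) = (\<Sum>i\<in>I. card (S i))"
    if S: "\<And>i. i \<in> I \<Longrightarrow> S i \<subseteq> MUSes (K i)" for S
  proof (rule card_UN_disjoint)
    show "\<forall>i\<in>I. finite (S i)"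
      using S fin finite_MUSes finite_subset by metis
    show "\<forall>i\<in>I. \<forall>j\<in>I. i \<noteq> j \<longrightarrow> S i \<inter> S j = {}"
    proof (intro ballI HOL.impI)
      fix i j assume "i \<in> I" "j \<in> I" "i \<noteq> j"
      then show "S i \<inter> S j = {}"
        using S[of i] S[of j] disj[of i j] by blast
    qed
  qed (rule assms(1))
  show ?thesis
  proof (rule antisym)
    obtain S where S: "MUS_packing (\<Union>i\<in>I. K i) S" "card S = I\<^sub>D (\<Union>i\<in>I. K i)"
      using ex_optimal_MUS_packing[OF finU] by blast
    \<comment> \<open>An optimal packing of the union is cut along the direct sum, each piece being
      a packing of its part.\<close>
    then have "S = (\<Union>i\<in>I. S \<inter> MUSes (K i))"
      using MUSes_eq by (auto simp: MUS_packing_def)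
    then have "card S = (\<Sum>i\<in>I. card (S \<inter> MUSes (K i)))"
      using card_UN[of "\<lambda>i. S \<inter> MUSes (K i)"] by simp
    also have "\<dots> \<le> (\<Sum>i\<in>I. I\<^sub>D (K i))"
      by (intro sum_mono MUS_packing_card_le fin MUS_packing_restrict[OF S(1)])
    finally show "I\<^sub>D (\<Union>i\<in>I. K i) \<le> (\<Sum>i\<in>I. I\<^sub>D (K i))"
      using S(2) by simp
  next
    \<comment> \<open>Conversely, optimal packings of the parts are merged into one of the
      union.\<close>
    have "\<forall>i\<in>I. \<exists>S. MUS_packing (K i) S \<and> card S = I\<^sub>D (K i)"
      using ex_optimal_MUS_packing fin by blast
    then obtain S where S: "\<And>i. i \<in> I \<Longrightarrow> MUS_packing (K i) (S i)"
      "\<And>i. i \<in> I \<Longrightarrow> card (S i) = I\<^sub>D (K i)"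
      by metis
    have "(\<Sum>i\<in>I. I\<^sub>D (K i)) = card (\<Union>i\<in>I. S i)"
      using card_UN[of S] S by (simp add: MUS_packing_def)
    also have "\<dots> \<le> I\<^sub>D (\<Union>i\<in>I. K i)"
      by (rule MUS_packing_card_le[OF finU MUS_packing_UN[OF MUSes_eq unfree_disj S(1)]])
    finally show "(\<Sum>i\<in>I. I\<^sub>D (K i)) \<le> I\<^sub>D (\<Union>i\<in>I. K i)" .
  qed
qed

text \<open>The sort \<open>finite\<close> on \<open>'a\<close> expresses that there are finitely
  many propositional symbols; the \<open>finite\<close> premises express that knowledge bases are
  finite sets.\<close>

theorem proposition11:
  shows "(\<forall>K :: 'a::finite form set. finite K \<longrightarrow> (I\<^sub>D K = 0 \<longleftrightarrow> consistent K)) \<and>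
    (\<forall>K K' :: 'a form set. finite K \<longrightarrow> finite K' \<longrightarrow> I\<^sub>D K \<le> I\<^sub>D (K \<union> K')) \<and>
    (\<forall>(K :: 'a form set) \<alpha>. finite K \<longrightarrow> \<alpha> \<in> free (K \<union> {\<alpha>}) \<longrightarrow>
       I\<^sub>D (K \<union> {\<alpha>}) = I\<^sub>D K) \<and>
    (\<forall>K :: 'a form set. finite K \<longrightarrow> (\<forall>M \<in> MUSes K. I\<^sub>D M = 1)) \<and>
    (\<forall>n \<ge> 1. \<forall>K :: nat \<Rightarrow> 'a form set.
       (\<forall>i \<in> {1..n}. finite (K i)) \<longrightarrow>
       is_oplus (MUSes (\<Union>i\<in>{1..n}. K i)) (\<lambda>i. MUSes (K i)) {1..n} \<longrightarrow>
       (\<forall>i \<in> {1..n}. \<forall>j \<in> {1..n}. i \<noteq> j \<longrightarrow> unfree (K i) \<inter> unfree (K j) = {}) \<longrightarrow>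
       I\<^sub>D (\<Union>i\<in>{1..n}. K i) = (\<Sum>i=1..n. I\<^sub>D (K i)))"
proof (intro HOL.conjI allI HOL.impI ballI)
  fix K :: "'a form set"
  assume "finite K"
  then show "I\<^sub>D K = 0 \<longleftrightarrow> consistent K"
    by (rule degree_eq_0_iff)
next
  fix K K' :: "'a form set"
  assume "finite K" "finite K'"
  then show "I\<^sub>D K \<le> I\<^sub>D (K \<union> K')"
    by (intro degree_le_if_MUSes_subset MUSes_mono) auto
next
  fix K :: "'a form set" and \<alpha>
  assume "finite K" "\<alpha> \<in> free (K \<union> {\<alpha>})"
  then show "I\<^sub>D (K \<union> {\<alpha>}) = I\<^sub>D K"
    \<comment> \<open>Adding a free formula leaves the set of MUSes unchanged, so both inequalities
      hold.\<close>
    by (intro antisym degree_le_if_MUSes_subset) (simp_all only: MUSes_insert_free finite_Un finite.intros order.refl simp_thms)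
next
  fix K M :: "'a form set"
  assume "finite K" "M \<in> MUSes K"
  then show "I\<^sub>D M = 1"
    by (rule degree_MUS)
next
  fix n :: nat and K :: "nat \<Rightarrow> 'a form set"
  assume "\<forall>i\<in>{1..n}. finite (K i)"
    and "is_oplus (MUSes (\<Union>i\<in>{1..n}. K i)) (\<lambda>i. MUSes (K i)) {1..n}"
    and "\<forall>i\<in>{1..n}. \<forall>j\<in>{1..n}. i \<noteq> j \<longrightarrow> unfree (K i) \<inter> unfree (K j) = {}"
  then show "I\<^sub>D (\<Union>i\<in>{1..n}. K i) = (\<Sum>i=1..n. I\<^sub>D (K i))"
    by (intro degree_UN) blast+
qed

end
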